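(* Let $(\mathbb{L}, I)$ be a set of lines with an incidence relation satisfying Axioms [1]–[4] and the assumption of projectivity. Let $u, v, w$ be pairwise skew lines. If the point $P$ lies on a line of the regulus $[uvw]$ (that is, $P \cap [uvw] \neq \emptyset$), then $P$ lies on a line of its conjugate regulus (that is, there is a line $r \in P$ belonging to the regulus conjugate to $[uvw]$).
   Context: Framework. $\mathbb{L}$ is a set whose elements are called lines, equipped with a symmetric reflexive relation $I$ called incidence ("$a$ meets $b$" means $a \, I \, b$). For $S \subseteq \mathbb{L}$, $S^{I}$ denotes the set of all lines incident to each line in $S$; write $l^{I} = \{l\}^{I}$, $[l_1 \dots l_n] = \{l_1,\dots,l_n\}^{I}$ and $[ab]^{I} = ([ab])^{I}$. Lines $a, b$ are skew if they are not incident; a skew pair in a set is a pair of skew lines both in the set. The axioms are as follows. Axiom [1]: for each line $l$ the set $l^{I}$ contains three pairwise skew lines. Axiom [2]: for each incident pair of distinct lines $a, b$: [2.1] $[ab]$ contains skew pairs of lines; [2.2] if $c \in [ab] \setminus [ab]^{I}$ (i.e. $c$ is one of a skew pair in $[ab]$) then $[abc]$ contains no skew pairs; [2.3] if $x, y$ is a skew pair in $[ab]$ then $[ab] = [abx] \cup [aby]$. Axiom [3]: if $a, b$ is an incident pair of distinct lines and $c \in [ab] \setminus [ab]^{I}$, then there exist an incident pair of distinct lines $p, q$ and $r \in [pq] \setminus [pq]^{I}$ such that $[abc] \cap [pqr] = \emptyset$. Points and planes: for distinct incident $a, b$, incidence restricts to an equivalence relation on $\Sigma(a,b) = [ab] \setminus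 [ab]^{I}$ with exactly two classes. These classes are labelled $\Sigma_{\curlyvee}(a,b)$ and $\Sigma_{\triangledown}(a,b)$ (one labelling fixed for each unordered pair $\{a,b\}$, so that Axiom [4] holds). The set $a \curlyvee b = [abc]$ for any $c \in \Sigma_{\curlyvee}(a,b)$ is independent of the choice of $c$ and is called a point; the set $a \triangledown b = [abc]$ for any $c \in \Sigma_{\triangledown}(a,b)$ is independent of the choice of $c$ and is called a plane. Every point is a set of lines of the form $a \curlyvee b$. Axiom [4]: whenever $a, b$ and $p, q$ are pairs of distinct incident lines, $(a \curlyvee b) \cap (p \curlyvee q) \neq \emptyset$ and $(a \triangledown b) \cap (p \triangledown q) \neq \emptyset$. Terminology: a point $P$ lies on a line $l$ iff $l \in P$. Regulus: a regulus is a set of the form $[uvw]$ where $u, v, w$ are pairwise skew lines. Every regulus contains at least three lines, and distinct lines in a regulus are skew. Assumption of projectivity: for all pairwise skew lines $u, v, w$ and all distinct lines $a, b, c, d \in [uvw]$, if a line meets three of $a, b, c, d$ then it meets the fourth. (Equivalently: for all pairwise skew $u, v, w$ and distinct $x, y, z \in [uvw]$, every $l \in [uvw]$ meets every $m \in [xyz]$.) Conjugate regulus: under the assumption of projectivity, the regulus conjugate to $[uvw]$ is the regulus $[xyz]$ where $x, y, z$ are any three distinct lines in $[uvw]$; it does not depend on the choice of $x, y, z$. *)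

theory Defs
  imports Main
begin

text \<open>
  The set of lines is the type \<open>'a\<close>; an incidence relation is a binary predicate on it.
  \<open>inc_all I S\<close> is the set written $S^I$; in particular $[l_1 \dots l_n]$ is
  \<open>inc_all I {l1, ..., ln}\<close> and $[ab]^I$ is \<open>inc_all I (inc_all I {a, b})\<close>.
\<close>

definition inc_all :: "('a \<Rightarrow> 'a \<Rightarrow> bool) \<Rightarrow> 'a set \<Rightarrow> 'a set" where
  "inc_all I S = {l. \<forall>s\<in>S. I l s}"

definition skew :: "('a \<Rightarrow> 'a \<Rightarrow> bool) \<Rightarrow> 'a \<Rightarrow> 'a \<Rightarrow> bool" where
  "skew I a b \<longleftrightarrow> \<not> I a b"

definition pairwise_skew :: "('a \<Rightarrow> 'a \<Rightarrow> bool) \<Rightarrow> 'a \<Rightarrow> 'a \<Rightarrow> 'a \<Rightarrow> bool" where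
  "pairwise_skew I u v w \<longleftrightarrow> skew I u v \<and> skew I u w \<and> skew I v w"

definition has_skew_pair :: "('a \<Rightarrow> 'a \<Rightarrow> bool) \<Rightarrow> 'a set \<Rightarrow> bool" where
  "has_skew_pair I S \<longleftrightarrow> (\<exists>x\<in>S. \<exists>y\<in>S. skew I x y)"

definition inc_pair :: "('a \<Rightarrow> 'a \<Rightarrow> bool) \<Rightarrow> 'a \<Rightarrow> 'a \<Rightarrow> bool" where
  "inc_pair I a b \<longleftrightarrow> a \<noteq> b \<and> I a b"

definition Sigma_lines :: "('a \<Rightarrow> 'a \<Rightarrow> bool) \<Rightarrow> 'a \<Rightarrow> 'a \<Rightarrow> 'a set" where
  "Sigma_lines I a b = inc_all I {a, b} - inc_all I (inc_all I {a, b})"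

locale line_space =
  fixes I :: "'a \<Rightarrow> 'a \<Rightarrow> bool"
  assumes inc_refl: "I a a"
    and inc_sym: "I a b \<Longrightarrow> I b a"
    and axiom1: "\<exists>x y z. {x, y, z} \<subseteq> inc_all I {l} \<and> pairwise_skew I x y z"
    and axiom2_1: "inc_pair I a b \<Longrightarrow> has_skew_pair I (inc_all I {a, b})"
    and axiom2_2: "inc_pair I a b \<Longrightarrow> c \<in> Sigma_lines I a b \<Longrightarrow>
      \<not> has_skew_pair I (inc_all I {a, b, c})"
    and axiom2_3: "inc_pair I a b \<Longrightarrow> x \<in> inc_all I {a, b} \<Longrightarrow> y \<in> inc_all I {a, b} \<Longrightarrow>
      skew I x y \<Longrightarrow> inc_all I {a, b} = inc_all I {a, b, x} \<union> inc_all I {a, b, y}"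
    and axiom3: "inc_pair I a b \<Longrightarrow> c \<in> Sigma_lines I a b \<Longrightarrow>
      \<exists>p q r. inc_pair I p q \<and> r \<in> Sigma_lines I p q \<and>
        inc_all I {a, b, c} \<inter> inc_all I {p, q, r} = {}"
begin

lemma equiv_Sigma_lines:
  assumes "inc_pair I a b"
  shows "equiv (Sigma_lines I a b)
    {(x, y). x \<in> Sigma_lines I a b \<and> y \<in> Sigma_lines I a b \<and> I x y}"
proof (rule equivI)
  let ?S = "Sigma_lines I a b"
  let ?R = "{(x, y). x \<in> ?S \<and> y \<in> ?S \<and> I x y}"
  show "?R \<subseteq> ?S \<times> ?S" by auto
  show "refl_on ?S ?R" by (auto simp: refl_on_def inc_refl)
  show "sym ?R" by (auto simp: sym_def intro: inc_sym)
  have "I x z" if "x \<in> ?S" "y \<in> ?S" "z \<in> ?S" "I x y" "I y z" for x y z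
  proof -
    have "x \<in> inc_all I {a, b, y}" "z \<in> inc_all I {a, b, y}"
      using that by (auto simp: Sigma_lines_def inc_all_def intro: inc_sym)
    with axiom2_2[OF assms that(2)] show ?thesis
      by (auto simp: has_skew_pair_def skew_def)
  qed
  then show "trans ?R" by (auto simp: trans_def)
qed

end

text \<open>
  The two functions \<open>Sig_pt\<close> and \<open>Sig_pl\<close> label the two incidence classes of
  \<open>Sigma_lines I a b\<close>. Their values are constrained only for distinct incident arguments.
\<close>

definition sigma_labelling ::
  "('a \<Rightarrow> 'a \<Rightarrow> bool) \<Rightarrow> ('a \<Rightarrow> 'a \<Rightarrow> 'a set) \<Rightarrow> ('a \<Rightarrow> 'a \<Rightarrow> 'a set) \<Rightarrow> bool" where
  "sigma_labelling I Sig_pt Sig_pl \<longleftrightarrow>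
    (\<forall>a b. inc_pair I a b \<longrightarrow>
      Sigma_lines I a b // {(x, y). x \<in> Sigma_lines I a b \<and> y \<in> Sigma_lines I a b \<and> I x y}
        = {Sig_pt a b, Sig_pl a b} \<and>
      Sig_pt a b \<noteq> Sig_pl a b \<and>
      Sig_pt a b = Sig_pt b a \<and> Sig_pl a b = Sig_pl b a)"

text \<open>
  The set $[abc]$ for any \<open>c\<close> in the chosen class \<open>Sig a b\<close>: with \<open>Sig = Sig_pt\<close> it is the
  point and with \<open>Sig = Sig_pl\<close> the plane determined by \<open>a\<close> and \<open>b\<close>.
\<close>

definition span_of ::
  "('a \<Rightarrow> 'a \<Rightarrow> bool) \<Rightarrow> ('a \<Rightarrow> 'a \<Rightarrow> 'a set) \<Rightarrow> 'a \<Rightarrow> 'a \<Rightarrow> 'a set" where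
  "span_of I Sig a b = inc_all I {a, b, SOME c. c \<in> Sig a b}"

definition is_point ::
  "('a \<Rightarrow> 'a \<Rightarrow> bool) \<Rightarrow> ('a \<Rightarrow> 'a \<Rightarrow> 'a set) \<Rightarrow> 'a set \<Rightarrow> bool" where
  "is_point I Sig_pt P \<longleftrightarrow> (\<exists>a b. inc_pair I a b \<and> P = span_of I Sig_pt a b)"

locale labelled_line_space = line_space I
  for I :: "'a \<Rightarrow> 'a \<Rightarrow> bool" +
  fixes Sig_pt Sig_pl :: "'a \<Rightarrow> 'a \<Rightarrow> 'a set"
  assumes labelling: "sigma_labelling I Sig_pt Sig_pl"
    and axiom4_points: "inc_pair I a b \<Longrightarrow> inc_pair I p q \<Longrightarrow>
      span_of I Sig_pt a b \<inter> span_of I Sig_pt p q \<noteq> {}"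
    and axiom4_planes: "inc_pair I a b \<Longrightarrow> inc_pair I p q \<Longrightarrow>
      span_of I Sig_pl a b \<inter> span_of I Sig_pl p q \<noteq> {}"
begin

lemma span_of_eq:
  assumes ab: "inc_pair I a b" and Sig: "Sig \<in> {Sig_pt, Sig_pl}" and c: "c \<in> Sig a b"
  shows "span_of I Sig a b = inc_all I {a, b, c}"
proof -
  let ?S = "Sigma_lines I a b"
  let ?R = "{(x, y). x \<in> ?S \<and> y \<in> ?S \<and> I x y}"
  define d where "d = (SOME c. c \<in> Sig a b)"
  have d: "d \<in> Sig a b" unfolding d_def using c by (rule someI)
  have "Sig a b \<in> ?S // ?R"
    using labelling ab Sig unfolding sigma_labelling_def by auto
  from quotient_eq_iff[OF equiv_Sigma_lines[OF ab] this this c d]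
  have cd: "c \<in> ?S" "d \<in> ?S" "I c d" by auto
  have *: "inc_all I {a, b, x} \<subseteq> inc_all I {a, b, y}"
    if "x \<in> ?S" "y \<in> ?S" "I x y" for x y
  proof
    fix l assume l: "l \<in> inc_all I {a, b, x}"
    have "y \<in> inc_all I {a, b, x}"
      using that inc_sym[OF that(3)] by (simp add: Sigma_lines_def inc_all_def)
    with l axiom2_2[OF ab that(1)] have "I l y"
      by (auto simp: has_skew_pair_def skew_def)
    with l show "l \<in> inc_all I {a, b, y}" by (simp add: inc_all_def)
  qed
  from *[OF cd] *[OF cd(2,1) inc_sym[OF cd(3)]] show ?thesis
    unfolding span_of_def d_def[symmetric] by blast
qed

end

definition projectivity :: "('a \<Rightarrow> 'a \<Rightarrow> bool) \<Rightarrow> bool" where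
  "projectivity I \<longleftrightarrow>
    (\<forall>u v w a b c d l. pairwise_skew I u v w \<longrightarrow>
      {a, b, c, d} \<subseteq> inc_all I {u, v, w} \<longrightarrow> distinct [a, b, c, d] \<longrightarrow>
      I l a \<longrightarrow> I l b \<longrightarrow> I l c \<longrightarrow> I l d)"

definition regulus :: "('a \<Rightarrow> 'a \<Rightarrow> bool) \<Rightarrow> 'a \<Rightarrow> 'a \<Rightarrow> 'a \<Rightarrow> 'a set" where
  "regulus I u v w = inc_all I {u, v, w}"

definition conjugate_regulus :: "('a \<Rightarrow> 'a \<Rightarrow> bool) \<Rightarrow> 'a set \<Rightarrow> 'a set" where
  "conjugate_regulus I R =
    (THE C. \<exists>x y z. {x, y, z} \<subseteq> R \<and> distinct [x, y, z] \<and> C = regulus I x y z)"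

lemma conjugate_regulus_eq:
  assumes proj: "projectivity I" and uvw: "pairwise_skew I u v w"
    and xyz: "{x, y, z} \<subseteq> regulus I u v w" "distinct [x, y, z]"
  shows "conjugate_regulus I (regulus I u v w) = regulus I x y z"
proof -
  have *: "regulus I p q r = inc_all I (regulus I u v w)"
    if pqr: "{p, q, r} \<subseteq> regulus I u v w" "distinct [p, q, r]" for p q r
  proof
    show "inc_all I (regulus I u v w) \<subseteq> regulus I p q r"
      using pqr by (auto simp: regulus_def inc_all_def)
    show "regulus I p q r \<subseteq> inc_all I (regulus I u v w)"
    proof
      fix l assume "l \<in> regulus I p q r"
      then have l: "I l p" "I l q" "I l r" by (auto simp: regulus_def inc_all_def)
      have "I l s" if s: "s \<in> regulus I u v w" for s
      proof (cases "s \<in> {p, q, r}")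
        case False
        then have "distinct [p, q, r, s]" "{p, q, r, s} \<subseteq> inc_all I {u, v, w}"
          using pqr s by (auto simp: regulus_def)
        with proj uvw l show ?thesis unfolding projectivity_def by blast
      qed (use l in auto)
      then show "l \<in> inc_all I (regulus I u v w)" by (simp add: inc_all_def)
    qed
  qed
  show ?thesis unfolding conjugate_regulus_def
  proof (rule the_equality)
    show "\<exists>x' y' z'. {x', y', z'} \<subseteq> regulus I u v w \<and> distinct [x', y', z'] \<and>
        regulus I x y z = regulus I x' y' z'"
      using xyz by blast
  next
    fix C
    assume "\<exists>x' y' z'. {x', y', z'} \<subseteq> regulus I u v w \<and> distinct [x', y', z'] \<and>
        C = regulus I x' y' z'"
    then show "C = regulus I x y z" using *[OF xyz] * by metis
  qed
qed

end

theory Submission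
  imports Defs
begin

text \<open>
  Let \<open>m\<close> be a line of the regulus $[uvw]$ through the point \<open>P\<close>, and let \<open>x\<close>, \<open>y\<close> be two further
  lines of that regulus. The line sought is the transversal from \<open>P\<close> to \<open>x\<close> and \<open>y\<close>: it meets \<open>m\<close>
  in \<open>P\<close>, so it meets three lines of $[uvw]$ and hence belongs to the conjugate regulus $[mxy]$.

  The main step is thus \<open>transversal_through_point\<close>. Given a point \<open>P\<close> on a line \<open>m\<close> skew to \<open>x\<close> and
  \<open>y\<close>, joining \<open>P\<close> to two points of \<open>x\<close> gives two lines of \<open>P\<close> that span with \<open>x\<close> a plane, and likewise
  for \<open>y\<close>. The two planes share a line by Axiom [4]; it meets \<open>x\<close> and \<open>y\<close>, and it passes
  through \<open>P\<close> unless one of the joining lines already is a transversal.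

  The same lemma shows that a regulus has enough lines: from each of three points of \<open>u\<close> there is
  a transversal to \<open>v\<close> and \<open>w\<close> (\<open>regulus_three_lines\<close>).

  All this rests on elementary projective geometry derived from the axioms: points and planes are
  equal to their own sets of common transversals (\<open>flat_closed\<close>), no point is a plane
  (\<open>point_not_plane\<close>), and a point is determined by two of its lines (\<open>point_eq_span\<close>).
\<close>

section \<open>Flats as maximal sets of mutually incident lines\<close>

lemma inc_all_insert: "l \<in> inc_all I (insert s S) \<longleftrightarrow> I l s \<and> l \<in> inc_all I S"
  by (simp add: inc_all_def)

lemma inc_all_empty: "l \<in> inc_all I {}"
  by (simp add: inc_all_def)

lemmas inc_all_simps = inc_all_insert inc_all_empty

context line_space
begin

text \<open>Points and planes alike, before the labelling tells them apart.\<close>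

definition flat :: "'a set \<Rightarrow> bool" where
  "flat F \<longleftrightarrow> (\<exists>a b c. inc_pair I a b \<and> c \<in> Sigma_lines I a b \<and> F = inc_all I {a, b, c})"

lemma Sigma_linesI:
  assumes "c \<in> inc_all I {a, b}" "d \<in> inc_all I {a, b}" "\<not> I c d"
  shows "c \<in> Sigma_lines I a b"
  using assms unfolding Sigma_lines_def inc_all_def by blast

lemma flat_incident:
  assumes "flat F" "x \<in> F" "y \<in> F"
  shows "I x y"
proof -
  obtain a b c where "inc_pair I a b" "c \<in> Sigma_lines I a b" "F = inc_all I {a, b, c}"
    using assms(1) unfolding flat_def by blast
  then have "\<not> has_skew_pair I F"
    using axiom2_2 by simp
  then show ?thesis
    using assms(2,3) unfolding has_skew_pair_def skew_def by blast
qed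

text \<open>
  A flat $[abc]$ contains \<open>a\<close>, \<open>b\<close>, \<open>c\<close>, so a line that meets all its lines belongs to it; the
  converse inclusion is Axiom [2.2].
\<close>

lemma flat_closed:
  assumes F: "flat F"
  shows "inc_all I F = F"
proof
  obtain a b c where abc: "inc_pair I a b" "c \<in> Sigma_lines I a b" "F = inc_all I {a, b, c}"
    using F flat_def by auto
  then have "a \<in> F" "b \<in> F" "c \<in> F"
    using inc_refl inc_sym by (auto simp: inc_pair_def Sigma_lines_def inc_all_simps)
  then show "inc_all I F \<subseteq> F"
    unfolding abc(3) by (auto simp: inc_all_def)
  show "F \<subseteq> inc_all I F"
    using flat_incident[OF F] by (auto simp: inc_all_def)
qed

lemma flat_subset_eq:
  assumes "flat F" "flat G" "F \<subseteq> G"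
  shows "F = G"
proof -
  have "inc_all I G \<subseteq> inc_all I F"
    using assms(3) by (auto simp: inc_all_def)
  then show ?thesis
    using assms flat_closed by auto
qed

text \<open>
  With a skew pair \<open>s\<close>, \<open>t\<close> in $[pq]$, either all lines of the flat meet \<open>s\<close>, or some line \<open>g\<close> of
  the flat is skew to \<open>s\<close>. In either case a line of $\Sigma(p,q)$ meets the whole flat, and maximality
  gives equality.
\<close>

lemma flat_generated:
  assumes F: "flat F" and p: "p \<in> F" and q: "q \<in> F" and "p \<noteq> q"
  shows "inc_pair I p q \<and> (\<exists>r \<in> Sigma_lines I p q. F = inc_all I {p, q, r})"
proof
  show pq: "inc_pair I p q"
    using assms flat_incident by (auto simp: inc_pair_def)
  obtain s t where st: "s \<in> inc_all I {p, q}" "t \<in> inc_all I {p, q}" "\<not> I s t"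
    using axiom2_1[OF pq] unfolding has_skew_pair_def skew_def by blast
  have Fpq: "F \<subseteq> inc_all I {p, q}"
    using flat_incident[OF F] p q by (auto simp: inc_all_simps)
  have "\<exists>r \<in> Sigma_lines I p q. F \<subseteq> inc_all I {p, q, r}"
  proof (cases "\<forall>g\<in>F. I g s")
    case True
    then have "F \<subseteq> inc_all I {p, q, s}"
      using Fpq by (auto simp: inc_all_simps)
    then show ?thesis
      using Sigma_linesI[OF st] by blast
  next
    case False
    then obtain g where g: "g \<in> F" "\<not> I g s" by blast
    then have "g \<in> Sigma_lines I p q"
      using Sigma_linesI st(1) Fpq by blast
    moreover have "F \<subseteq> inc_all I {p, q, g}"
      using Fpq flat_incident[OF F _ g(1)] by (auto simp: inc_all_simps)
    ultimately show ?thesis by blast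
  qed
  then obtain r where r: "r \<in> Sigma_lines I p q" "F \<subseteq> inc_all I {p, q, r}" by blast
  then have "flat (inc_all I {p, q, r})"
    using pq flat_def by blast
  then show "\<exists>r \<in> Sigma_lines I p q. F = inc_all I {p, q, r}"
    using flat_subset_eq[OF F] r by blast
qed

text \<open>
  If \<open>x\<close> and \<open>y\<close> met, then Axiom [2.3] for the skew pair \<open>u\<close>, \<open>v\<close> in $[xy]$ would make \<open>w\<close> meet
  \<open>u\<close> or \<open>v\<close>.
\<close>

lemma regulus_skew:
  assumes uvw: "pairwise_skew I u v w"
    and x: "x \<in> regulus I u v w" and y: "y \<in> regulus I u v w" and "x \<noteq> y"
  shows "\<not> I x y"
proof
  assume "I x y"
  then have xy: "inc_pair I x y"
    using \<open>x \<noteq> y\<close> by (simp add: inc_pair_def)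
  have "u \<in> inc_all I {x, y}" "v \<in> inc_all I {x, y}" "w \<in> inc_all I {x, y}"
    using x y inc_sym by (auto simp: regulus_def inc_all_simps)
  moreover have "skew I u v" "\<not> I w u" "\<not> I w v"
    using uvw inc_sym by (auto simp: pairwise_skew_def skew_def)
  ultimately show False
    using axiom2_3[OF xy, of u v] by (auto simp: inc_all_simps)
qed

end

section \<open>Points as distinguished from planes\<close>

context labelled_line_space
begin

lemma Sigma_lines_classes:
  assumes ab: "inc_pair I a b"
  shows "Sigma_lines I a b = Sig_pt a b \<union> Sig_pl a b" "Sig_pt a b \<noteq> {}" "Sig_pl a b \<noteq> {}"
proof -
  let ?S = "Sigma_lines I a b"
  let ?R = "{(x, y). x \<in> ?S \<and> y \<in> ?S \<and> I x y}"
  have q: "?S // ?R = {Sig_pt a b, Sig_pl a b}"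
    using labelling ab by (auto simp: sigma_labelling_def)
  then show "?S = Sig_pt a b \<union> Sig_pl a b"
    using Union_quotient[OF equiv_Sigma_lines[OF ab]] by simp
  have "Sig_pt a b \<in> ?S // ?R" "Sig_pl a b \<in> ?S // ?R"
    unfolding q by simp_all
  then show "Sig_pt a b \<noteq> {}" "Sig_pl a b \<noteq> {}"
    using in_quotient_imp_non_empty[OF equiv_Sigma_lines[OF ab]] by blast+
qed

lemma flat_span:
  assumes "inc_pair I a b" "Sig \<in> {Sig_pt, Sig_pl}"
  shows "flat (span_of I Sig a b)"
proof -
  obtain c where "c \<in> Sig a b" "c \<in> Sigma_lines I a b"
    using Sigma_lines_classes[OF assms(1)] assms(2) by auto
  then show ?thesis
    using assms(1) unfolding flat_def span_of_eq[OF assms \<open>c \<in> Sig a b\<close>] by blast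
qed

lemma flat_cases:
  assumes "inc_pair I a b" "c \<in> Sigma_lines I a b"
  shows "inc_all I {a, b, c} \<in> {span_of I Sig_pt a b, span_of I Sig_pl a b}"
proof -
  have "c \<in> Sig_pt a b \<or> c \<in> Sig_pl a b"
    using assms(2) unfolding Sigma_lines_classes(1)[OF assms(1)] by (rule UnE) simp_all
  then show ?thesis
    using span_of_eq[OF assms(1), of Sig_pt c] span_of_eq[OF assms(1), of Sig_pl c]
    by (elim disjE) simp_all
qed

lemma flat_point: "is_point I Sig_pt P \<Longrightarrow> flat P"
  using flat_span[of _ _ Sig_pt] unfolding is_point_def by auto

lemma point_span: "inc_pair I a b \<Longrightarrow> is_point I Sig_pt (span_of I Sig_pt a b)"
  unfolding is_point_def by blast

lemma points_meet:
  assumes "is_point I Sig_pt P" "is_point I Sig_pt Q"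
  obtains l where "l \<in> P" "l \<in> Q"
proof -
  obtain a b p q where "inc_pair I a b" "P = span_of I Sig_pt a b"
      and "inc_pair I p q" "Q = span_of I Sig_pt p q"
    using assms unfolding is_point_def by blast
  then have "P \<inter> Q \<noteq> {}"
    using axiom4_points by simp
  then show ?thesis
    using that by blast
qed

text \<open>
  Axiom [3] supplies a flat disjoint from \<open>P\<close>. By Axiom [4] it is not a point if \<open>P\<close> is one, and not
  a plane if \<open>P\<close> is one, so \<open>P\<close> cannot be both.
\<close>

lemma point_not_plane:
  assumes P: "is_point I Sig_pt P" and ab: "inc_pair I a b"
  shows "P \<noteq> span_of I Sig_pl a b"
proof
  assume eq: "P = span_of I Sig_pl a b"
  obtain c d e where "inc_pair I c d" "e \<in> Sigma_lines I c d" "P = inc_all I {c, d, e}"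
    using flat_point[OF P] flat_def by auto
  then obtain p q r where pqr: "inc_pair I p q" "r \<in> Sigma_lines I p q"
      "P \<inter> inc_all I {p, q, r} = {}"
    using axiom3 by metis
  obtain c' d' where "inc_pair I c' d'" "P = span_of I Sig_pt c' d'"
    using P is_point_def by metis
  then have "P \<inter> span_of I Sig_pt p q \<noteq> {}"
    using axiom4_points pqr(1) by simp
  moreover have "P \<inter> span_of I Sig_pl p q \<noteq> {}"
    using axiom4_planes ab pqr(1) eq by simp
  ultimately show False
    using flat_cases[OF pqr(1,2)] pqr(3) by auto
qed

lemma point_eq_span:
  assumes P: "is_point I Sig_pt P" and "p \<in> P" "q \<in> P" "p \<noteq> q"
  shows "P = span_of I Sig_pt p q"
proof -
  obtain r where pq: "inc_pair I p q" and "r \<in> Sigma_lines I p q" "P = inc_all I {p, q, r}"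
    using flat_generated[OF flat_point[OF P]] assms by blast
  then have "P \<in> {span_of I Sig_pt p q, span_of I Sig_pl p q}"
    using flat_cases by simp
  then show ?thesis
    using point_not_plane[OF P pq] by blast
qed

text \<open>
  Three pairwise skew lines that meet \<open>x\<close> meet it in three different points. A line that the points
  have in common besides \<open>x\<close> would force two of them to coincide.
\<close>

lemma three_points_on_line:
  obtains A B C where
    "is_point I Sig_pt A" "is_point I Sig_pt B" "is_point I Sig_pt C"
    "x \<in> A" "x \<in> B" "x \<in> C" "A \<inter> B = {x}" "A \<inter> C = {x}" "B \<inter> C = {x}"
proof -
  obtain a b c where "{a, b, c} \<subseteq> inc_all I {x}" and "pairwise_skew I a b c"
    using axiom1 by blast
  then have meet: "I x a" "I x b" "I x c" and skew: "\<not> I a b" "\<not> I a c" "\<not> I b c"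
    using inc_sym by (auto simp: inc_all_simps pairwise_skew_def skew_def)
  then have pairs: "inc_pair I x a" "inc_pair I x b" "inc_pair I x c"
    using inc_sym unfolding inc_pair_def by blast+
  let ?Q = "span_of I Sig_pt x"
  have mem: "x \<in> ?Q d" "d \<in> ?Q d" if d: "inc_pair I x d" for d
  proof -
    obtain e where "e \<in> Sig_pt x d" "e \<in> inc_all I {x, d}"
      using Sigma_lines_classes[OF d] by (auto simp: Sigma_lines_def)
    then show "x \<in> ?Q d" "d \<in> ?Q d"
      using span_of_eq[OF d] d inc_refl inc_sym by (auto simp: inc_pair_def inc_all_simps)
  qed
  have "?Q d \<inter> ?Q e = {x}" if de: "inc_pair I x d" "inc_pair I x e" "\<not> I d e" for d e
  proof -
    have False if l: "l \<in> ?Q d" "l \<in> ?Q e" "l \<noteq> x" for l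
    proof -
      have "?Q d = ?Q e"
        using point_eq_span[OF point_span[OF de(1)] mem(1)[OF de(1)] l(1)]
          point_eq_span[OF point_span[OF de(2)] mem(1)[OF de(2)] l(2)] l(3) by simp
      then have "d \<in> ?Q e"
        using mem(2)[OF de(1)] by simp
      then show False
        using flat_incident[OF flat_point[OF point_span[OF de(2)]]] mem(2)[OF de(2)] de(3) by blast
    qed
    then show ?thesis
      using mem(1) de by blast
  qed
  then show ?thesis
    using that[of "?Q a" "?Q b" "?Q c"] point_span mem(1) pairs skew by simp
qed

section \<open>Transversals and the conjugate regulus\<close>

text \<open>
  The plane through a point and a line not on it: \<open>l\<close> and \<open>l'\<close> join \<open>P\<close> to two points of \<open>x\<close>. The
  hypothesis that \<open>x\<close> is skew to some line of \<open>P\<close> says that \<open>P\<close> does not lie on \<open>x\<close>.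
\<close>

lemma plane_of_point_and_line:
  assumes P: "is_point I Sig_pt P" and m: "m \<in> P" "\<not> I m x"
  obtains l l' where "l \<in> P" "l' \<in> P" "inc_pair I l l'" "I l x" "I l' x"
    "inc_all I {l, l', x} = span_of I Sig_pl l l'"
proof -
  obtain A B where A: "is_point I Sig_pt A" "x \<in> A" and B: "is_point I Sig_pt B" "x \<in> B"
      and AB: "A \<inter> B = {x}"
    by (rule three_points_on_line[of x])
  obtain l where l: "l \<in> P" "l \<in> A" using points_meet[OF P A(1)] .
  obtain l' where l': "l' \<in> P" "l' \<in> B" using points_meet[OF P B(1)] .
  have xP: "x \<notin> P"
    using flat_incident[OF flat_point[OF P]] m by blast
  then have ne: "l \<noteq> l'"
    using l l' AB by auto
  then have ll': "inc_pair I l l'"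
    using flat_incident[OF flat_point[OF P]] l l' by (simp add: inc_pair_def)
  have meet: "I l x" "I l' x"
    using flat_incident flat_point A B l l' by blast+
  have "x \<in> Sigma_lines I l l'"
  proof (rule Sigma_linesI)
    show "x \<in> inc_all I {l, l'}"
      using meet inc_sym by (simp add: inc_all_simps)
    show "m \<in> inc_all I {l, l'}"
      using flat_incident[OF flat_point[OF P]] m l l' by (simp add: inc_all_simps)
    show "\<not> I x m"
      using m inc_sym by blast
  qed
  then have "inc_all I {l, l', x} \<in> {span_of I Sig_pt l l', span_of I Sig_pl l l'}"
    by (rule flat_cases[OF ll'])
  moreover have "x \<in> inc_all I {l, l', x}"
    using meet inc_sym inc_refl by (simp add: inc_all_simps)
  moreover have "P = span_of I Sig_pt l l'"
    using point_eq_span[OF P] l l' ne by blast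
  ultimately show ?thesis
    using that l l' ll' meet xP by auto
qed

text \<open>
  Let \<open>l\<close>, \<open>l'\<close> span with \<open>x\<close> the plane of \<open>P\<close> and \<open>x\<close>, and \<open>k\<close>, \<open>k'\<close> span with \<open>y\<close> the plane of
  \<open>P\<close> and \<open>y\<close>. If \<open>k\<close> meets \<open>x\<close>, it is a transversal. Otherwise \<open>k\<close> lies outside the first plane, so
  $[l\,l'k]$ is the point \<open>P\<close>, and it contains the common line of the two planes.
\<close>

lemma transversal_through_point:
  assumes P: "is_point I Sig_pt P" and m: "m \<in> P" "\<not> I m x" "\<not> I m y"
  obtains r where "r \<in> P" "I r x" "I r y"
proof -
  obtain l l' where l: "l \<in> P" "l' \<in> P" "inc_pair I l l'" "I l x" "I l' x"
      "inc_all I {l, l', x} = span_of I Sig_pl l l'"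
    using plane_of_point_and_line[OF P m(1,2)] .
  obtain k k' where k: "k \<in> P" "k' \<in> P" "inc_pair I k k'" "I k y" "I k' y"
      "inc_all I {k, k', y} = span_of I Sig_pl k k'"
    using plane_of_point_and_line[OF P m(1,3)] .
  show ?thesis
  proof (cases "I k x")
    case True
    then show ?thesis using that k by blast
  next
    case False
    obtain r where "r \<in> inc_all I {l, l', x}" "r \<in> inc_all I {k, k', y}"
      using axiom4_planes[OF l(3) k(3)] l(6) k(6) by auto
    then have r: "I r l" "I r l'" "I r x" "I r k" "I r y"
      by (auto simp: inc_all_simps)
    have "k \<in> Sigma_lines I l l'"
    proof (rule Sigma_linesI)
      show "k \<in> inc_all I {l, l'}"
        using flat_incident[OF flat_point[OF P]] k l by (simp add: inc_all_simps)
      show "x \<in> inc_all I {l, l'}"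
        using l inc_sym by (simp add: inc_all_simps)
    qed (fact False)
    then have "flat (inc_all I {l, l', k})"
      using l(3) flat_def by blast
    moreover have "P \<subseteq> inc_all I {l, l', k}"
      using flat_incident[OF flat_point[OF P]] k l by (auto simp: inc_all_simps)
    ultimately have "P = inc_all I {l, l', k}"
      using flat_subset_eq flat_point[OF P] by blast
    then show ?thesis
      using that r by (simp add: inc_all_simps)
  qed
qed

lemma regulus_three_lines:
  assumes uvw: "pairwise_skew I u v w"
  obtains x y z where "{x, y, z} \<subseteq> regulus I u v w" "distinct [x, y, z]"
proof -
  have skew: "\<not> I u v" "\<not> I u w"
    using uvw by (auto simp: pairwise_skew_def skew_def)
  have ex: "\<exists>r \<in> Q. r \<in> regulus I u v w" if Q: "is_point I Sig_pt Q" "u \<in> Q" for Q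
  proof -
    obtain r where "r \<in> Q" "I r v" "I r w"
      using transversal_through_point[OF Q skew] .
    moreover have "I r u"
      using flat_incident[OF flat_point[OF Q(1)]] \<open>r \<in> Q\<close> Q(2) by blast
    ultimately show ?thesis
      by (auto simp: regulus_def inc_all_simps)
  qed
  have u: "u \<notin> regulus I u v w"
    using skew by (simp add: regulus_def inc_all_simps)
  obtain A B C where pts: "is_point I Sig_pt A" "is_point I Sig_pt B" "is_point I Sig_pt C"
      "u \<in> A" "u \<in> B" "u \<in> C" and int: "A \<inter> B = {u}" "A \<inter> C = {u}" "B \<inter> C = {u}"
    by (rule three_points_on_line[of u])
  obtain x y z where "x \<in> A" "y \<in> B" "z \<in> C" and xyz: "{x, y, z} \<subseteq> regulus I u v w"
    using ex pts by (meson empty_subsetI insert_subset)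
  then have "distinct [x, y, z]"
    using int u by auto
  with xyz show ?thesis using that by blast
qed

lemma point_on_conjugate_regulus:
  assumes proj: "projectivity I" and uvw: "pairwise_skew I u v w"
    and P: "is_point I Sig_pt P" and m: "m \<in> P" "m \<in> regulus I u v w"
  shows "\<exists>r\<in>P. r \<in> conjugate_regulus I (regulus I u v w)"
proof -
  obtain x y where xy: "x \<in> regulus I u v w" "y \<in> regulus I u v w" "distinct [m, x, y]"
  proof -
    obtain a b c where "{a, b, c} \<subseteq> regulus I u v w" "distinct [a, b, c]"
      using regulus_three_lines[OF uvw] .
    then show ?thesis
      using that[of a b] that[of a c] that[of b c] by auto
  qed
  then have "\<not> I m x" "\<not> I m y"
    using regulus_skew[OF uvw m(2)] by auto
  then obtain r where r: "r \<in> P" "I r x" "I r y"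
    using transversal_through_point[OF P m(1)] by blast
  moreover have "I r m"
    using flat_incident[OF flat_point[OF P]] r(1) m(1) by blast
  ultimately have "r \<in> regulus I m x y"
    by (simp add: regulus_def inc_all_simps)
  moreover have "conjugate_regulus I (regulus I u v w) = regulus I m x y"
    using conjugate_regulus_eq[OF proj uvw] m(2) xy by simp
  ultimately show ?thesis using r(1) by auto
qed

end

theorem theorem9:
  fixes I :: "'a \<Rightarrow> 'a \<Rightarrow> bool"
    and Sig_pt Sig_pl :: "'a \<Rightarrow> 'a \<Rightarrow> 'a set"
    and u v w :: 'a
    and P :: "'a set"
  assumes "labelled_line_space I Sig_pt Sig_pl"
    and "projectivity I"
    and "pairwise_skew I u v w"
    and "is_point I Sig_pt P"
    and "P \<inter> regulus I u v w \<noteq> {}"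
  shows "\<exists>r\<in>P. r \<in> conjugate_regulus I (regulus I u v w)"
proof -
  interpret labelled_line_space I Sig_pt Sig_pl by fact
  show ?thesis
    using point_on_conjugate_regulus assms by blast
qed

end
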